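(* Let $\mathbb{C}$ be a regular unital category with binary coproducts, comonadic covers $(P,\delta,\varepsilon)$ and a natural imaginary splitting $t$. Suppose that the values of $P$ are projective objects in $\mathbb{C}$. Let $f'\colon X'\to Y'$ with section $s'$ and kernel $k'\colon K'\to X'$, and $f\colon X\to Y$ with section $s$ and kernel $k\colon K\to X$, be intrinsic Schreier split extensions, and let $\gamma\colon K'\to K$, $g\colon X'\to X$, $h\colon Y'\to Y$ be morphisms such that $gk'=k\gamma$, $fg=hf'$ and $gs'=sh$. Then: (1) $g$ is a regular epimorphism if and only if $\gamma$ and $h$ are regular epimorphisms; (2) $g$ is a monomorphism if and only if $\gamma$ and $h$ are monomorphisms.
   Context: Setting. A pointed finitely complete category is unital when for all objects $A,B$ the pair $\langle 1_A,0\rangle\colon A\to A\times B$, $\langle 0,1_B\rangle\colon B\to A\times B$ is jointly extremal-epimorphic. "Comonadic covers" means a comonad $(P,\delta,\varepsilon)$ on $\mathbb{C}$ such that every $\varepsilon_X\colon P(X)\to X$ is a regular epimorphism. Projective means projective with respect to regular epimorphisms. A natural imaginary splitting is a natural transformation with components $t_{A,B}\colon P(A\times B)\to A+B$ such that $r_{A,B}t_{A,B}=\varepsilon_{A\times B}$, where $r_{A,B}\colon A+B\to A\times B$ is the canonical comparison morphism (with $\pi_A r_{A,B}=(1_A\;0)$ and $\pi_B r_{A,B}=(0\;1_B)$). Imaginary morphisms. An imaginary morphism $a\colon X\dashrightarrow Y$ is a morphism $a\colon P(X)\to Y$ in $\mathbb{C}$, i.e. a morphism of the Kleisli category of $P$;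 composition of $a\colon A\dashrightarrow B$ and $b\colon B\dashrightarrow C$ is $b\circ a=b\,P(a)\,\delta_A$. A real morphism $f\colon X\to Y$ of $\mathbb{C}$ is viewed as $\overline{f}=f\varepsilon_X\colon X\dashrightarrow Y$; for real $v$, $u$ one writes $v\circ a=va\;(=\overline{v}\circ a)$ and $a\circ u=aP(u)\;(=a\circ\overline{u})$. Finite products of $\mathbb{C}$ are also products for imaginary morphisms: $\langle a,b\rangle$ is the usual pairing in $\mathbb{C}$. Imaginary addition: $\mu^X\colon X\times X\dashrightarrow X$ is $\mu^X=(1_X\;1_X)\,t_{X,X}\colon P(X\times X)\to X+X\to X$. Intrinsic Schreier split epimorphism (also called, together with its kernel, intrinsic Schreier split extension): a split epimorphism $f\colon X\to Y$ with chosen section $s$ and kernel $k\colon K\to X$ for which there is an imaginary morphism $q\colon X\dashrightarrow K$ with $\mu^X\circ\langle k\circ q,\overline{sf}\rangle=\overline{1_X}$ and $q\circ\mu^X\circ(k\times s)=\overline{\pi_K}$, where $\pi_K\colon K\times Y\to K$ is the projection. *)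

theory Defs
  imports Main
begin

section \<open>Categories, functors and finite limits\<close>

record ('o, 'm) cat =
  Obj :: "'o set"
  Arr :: "'m set"
  Dom :: "'m \<Rightarrow> 'o"
  Cod :: "'m \<Rightarrow> 'o"
  Ident :: "'o \<Rightarrow> 'm"
  Comp :: "'m \<Rightarrow> 'm \<Rightarrow> 'm" (infixl "\<cdot>\<index>" 70)

definition hom :: "('o, 'm, 'z) cat_scheme \<Rightarrow> 'o \<Rightarrow> 'o \<Rightarrow> 'm set" where
  "hom C A B = {f \<in> Arr C. Dom C f = A \<and> Cod C f = B}"

locale category =
  fixes C :: "('o, 'm, 'z) cat_scheme" (structure)
  assumes dom_obj: "f \<in> Arr C \<Longrightarrow> Dom C f \<in> Obj C"
    and cod_obj: "f \<in> Arr C \<Longrightarrow> Cod C f \<in> Obj C"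
    and ident_hom: "A \<in> Obj C \<Longrightarrow> Ident C A \<in> hom C A A"
    and comp_hom: "f \<in> hom C A B \<Longrightarrow> g \<in> hom C B D \<Longrightarrow> g \<cdot> f \<in> hom C A D"
    and comp_ident_right: "f \<in> hom C A B \<Longrightarrow> f \<cdot> Ident C A = f"
    and comp_ident_left: "f \<in> hom C A B \<Longrightarrow> Ident C B \<cdot> f = f"
    and comp_assoc: "f \<in> hom C A B \<Longrightarrow> g \<in> hom C B D \<Longrightarrow> h \<in> hom C D E
      \<Longrightarrow> h \<cdot> (g \<cdot> f) = (h \<cdot> g) \<cdot> f"

definition is_functor ::
  "('i, 'j, 'y) cat_scheme \<Rightarrow> ('o, 'm, 'z) cat_scheme \<Rightarrow> ('i \<Rightarrow> 'o) \<Rightarrow> ('j \<Rightarrow> 'm) \<Rightarrow> bool" where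
  "is_functor J C Fo Fm \<longleftrightarrow>
     (\<forall>i\<in>Obj J. Fo i \<in> Obj C) \<and>
     (\<forall>a\<in>Arr J. Fm a \<in> hom C (Fo (Dom J a)) (Fo (Cod J a))) \<and>
     (\<forall>i\<in>Obj J. Fm (Ident J i) = Ident C (Fo i)) \<and>
     (\<forall>a\<in>Arr J. \<forall>b\<in>Arr J. Dom J b = Cod J a \<longrightarrow> Fm (b \<cdot>\<^bsub>J\<^esub> a) = Fm b \<cdot>\<^bsub>C\<^esub> Fm a)"

definition is_cone ::
  "('i, 'j, 'y) cat_scheme \<Rightarrow> ('o, 'm, 'z) cat_scheme \<Rightarrow> ('i \<Rightarrow> 'o) \<Rightarrow> ('j \<Rightarrow> 'm)
     \<Rightarrow> 'o \<Rightarrow> ('i \<Rightarrow> 'm) \<Rightarrow> bool" where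
  "is_cone J C Fo Fm L l \<longleftrightarrow>
     L \<in> Obj C \<and>
     (\<forall>i\<in>Obj J. l i \<in> hom C L (Fo i)) \<and>
     (\<forall>a\<in>Arr J. Fm a \<cdot>\<^bsub>C\<^esub> l (Dom J a) = l (Cod J a))"

definition is_limit ::
  "('i, 'j, 'y) cat_scheme \<Rightarrow> ('o, 'm, 'z) cat_scheme \<Rightarrow> ('i \<Rightarrow> 'o) \<Rightarrow> ('j \<Rightarrow> 'm)
     \<Rightarrow> 'o \<Rightarrow> ('i \<Rightarrow> 'm) \<Rightarrow> bool" where
  "is_limit J C Fo Fm L l \<longleftrightarrow>
     is_cone J C Fo Fm L l \<and>
     (\<forall>L' l'. is_cone J C Fo Fm L' l' \<longrightarrow>
        (\<exists>!u. u \<in> hom C L' L \<and> (\<forall>i\<in>Obj J. l i \<cdot>\<^bsub>C\<^esub> u = l' i)))"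

text \<open>Every finite category is isomorphic to one whose objects and arrows are natural
  numbers, so it is enough to let the shape range over such categories.\<close>

definition finitely_complete :: "('o, 'm, 'z) cat_scheme \<Rightarrow> bool" where
  "finitely_complete C \<longleftrightarrow>
     (\<forall>(J :: (nat, nat) cat) Fo Fm.
        category J \<and> finite (Obj J) \<and> finite (Arr J) \<and> is_functor J C Fo Fm \<longrightarrow>
        (\<exists>L l. is_limit J C Fo Fm L l))"

section \<open>Monomorphisms, regular epimorphisms, regular categories\<close>

definition monic :: "('o, 'm, 'z) cat_scheme \<Rightarrow> 'm \<Rightarrow> bool" where
  "monic C m \<longleftrightarrow> m \<in> Arr C \<and>
     (\<forall>T. \<forall>u\<in>hom C T (Dom C m). \<forall>v\<in>hom C T (Dom C m).
        m \<cdot>\<^bsub>C\<^esub> u = m \<cdot>\<^bsub>C\<^esub> v \<longrightarrow> u = v)"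

definition isomorphism :: "('o, 'm, 'z) cat_scheme \<Rightarrow> 'm \<Rightarrow> bool" where
  "isomorphism C f \<longleftrightarrow> f \<in> Arr C \<and>
     (\<exists>g\<in>hom C (Cod C f) (Dom C f).
        g \<cdot>\<^bsub>C\<^esub> f = Ident C (Dom C f) \<and> f \<cdot>\<^bsub>C\<^esub> g = Ident C (Cod C f))"

definition is_coequalizer :: "('o, 'm, 'z) cat_scheme \<Rightarrow> 'm \<Rightarrow> 'm \<Rightarrow> 'm \<Rightarrow> bool" where
  "is_coequalizer C e u v \<longleftrightarrow>
     e \<in> Arr C \<and> u \<in> Arr C \<and> v \<in> hom C (Dom C u) (Cod C u) \<and> Dom C e = Cod C u \<and>
     e \<cdot>\<^bsub>C\<^esub> u = e \<cdot>\<^bsub>C\<^esub> v \<and>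
     (\<forall>D. \<forall>h\<in>hom C (Dom C e) D. h \<cdot>\<^bsub>C\<^esub> u = h \<cdot>\<^bsub>C\<^esub> v \<longrightarrow>
        (\<exists>!w. w \<in> hom C (Cod C e) D \<and> w \<cdot>\<^bsub>C\<^esub> e = h))"

definition regular_epi :: "('o, 'm, 'z) cat_scheme \<Rightarrow> 'm \<Rightarrow> bool" where
  "regular_epi C e \<longleftrightarrow> (\<exists>u v. is_coequalizer C e u v)"

definition is_pullback :: "('o, 'm, 'z) cat_scheme \<Rightarrow> 'm \<Rightarrow> 'm \<Rightarrow> 'm \<Rightarrow> 'm \<Rightarrow> bool" where
  "is_pullback C p q f g \<longleftrightarrow>
     f \<in> Arr C \<and> g \<in> Arr C \<and> Cod C f = Cod C g \<and>
     p \<in> Arr C \<and> q \<in> Arr C \<and> Dom C p = Dom C q \<and> Cod C p = Dom C f \<and> Cod C q = Dom C g \<and>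
     f \<cdot>\<^bsub>C\<^esub> p = g \<cdot>\<^bsub>C\<^esub> q \<and>
     (\<forall>T. \<forall>a\<in>hom C T (Dom C f). \<forall>b\<in>hom C T (Dom C g). f \<cdot>\<^bsub>C\<^esub> a = g \<cdot>\<^bsub>C\<^esub> b \<longrightarrow>
        (\<exists>!w. w \<in> hom C T (Dom C p) \<and> p \<cdot>\<^bsub>C\<^esub> w = a \<and> q \<cdot>\<^bsub>C\<^esub> w = b))"

definition regular_category :: "('o, 'm, 'z) cat_scheme \<Rightarrow> bool" where
  "regular_category C \<longleftrightarrow>
     category C \<and> finitely_complete C \<and>
     (\<forall>f p q. is_pullback C p q f f \<longrightarrow> (\<exists>e. is_coequalizer C e p q)) \<and>
     (\<forall>p q f g. is_pullback C p q f g \<and> regular_epi C g \<longrightarrow> regular_epi C p)"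

definition projective :: "('o, 'm, 'z) cat_scheme \<Rightarrow> 'o \<Rightarrow> bool" where
  "projective C R \<longleftrightarrow> R \<in> Obj C \<and>
     (\<forall>e. regular_epi C e \<longrightarrow>
        (\<forall>f\<in>hom C R (Cod C e). \<exists>l\<in>hom C R (Dom C e). e \<cdot>\<^bsub>C\<^esub> l = f))"

section \<open>Zero morphisms and kernels\<close>

definition zero_object :: "('o, 'm, 'z) cat_scheme \<Rightarrow> 'o \<Rightarrow> bool" where
  "zero_object C Z \<longleftrightarrow> Z \<in> Obj C \<and>
     (\<forall>A\<in>Obj C. (\<exists>!f. f \<in> hom C A Z) \<and> (\<exists>!f. f \<in> hom C Z A))"

definition pointed :: "('o, 'm, 'z) cat_scheme \<Rightarrow> bool" where
  "pointed C \<longleftrightarrow> (\<exists>Z. zero_object C Z)"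

definition zero_arr :: "('o, 'm, 'z) cat_scheme \<Rightarrow> 'o \<Rightarrow> 'o \<Rightarrow> 'm" where
  "zero_arr C A B = (THE z. \<exists>Z u v. zero_object C Z \<and> u \<in> hom C A Z \<and> v \<in> hom C Z B \<and>
     z = v \<cdot>\<^bsub>C\<^esub> u)"

definition is_kernel :: "('o, 'm, 'z) cat_scheme \<Rightarrow> 'm \<Rightarrow> 'm \<Rightarrow> bool" where
  "is_kernel C k f \<longleftrightarrow>
     f \<in> Arr C \<and> k \<in> Arr C \<and> Cod C k = Dom C f \<and>
     f \<cdot>\<^bsub>C\<^esub> k = zero_arr C (Dom C k) (Cod C f) \<and>
     (\<forall>T. \<forall>a\<in>hom C T (Dom C f). f \<cdot>\<^bsub>C\<^esub> a = zero_arr C T (Cod C f) \<longrightarrow>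
        (\<exists>!w. w \<in> hom C T (Dom C k) \<and> k \<cdot>\<^bsub>C\<^esub> w = a))"

section \<open>Binary products and coproducts\<close>

text \<open>Products and coproducts are carried as structure, so that expressions such as
  $P(A \times B)$ and $A + B$ denote objects; the choice is arbitrary.\<close>

record ('o, 'm) prod_cat = "('o, 'm) cat" +
  Prod :: "'o \<Rightarrow> 'o \<Rightarrow> 'o"
  Pr1 :: "'o \<Rightarrow> 'o \<Rightarrow> 'm"
  Pr2 :: "'o \<Rightarrow> 'o \<Rightarrow> 'm"

record ('o, 'm) prod_coprod_cat = "('o, 'm) prod_cat" +
  Coprod :: "'o \<Rightarrow> 'o \<Rightarrow> 'o"
  In1 :: "'o \<Rightarrow> 'o \<Rightarrow> 'm"
  In2 :: "'o \<Rightarrow> 'o \<Rightarrow> 'm"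

definition binary_products :: "('o, 'm, 'z) prod_cat_scheme \<Rightarrow> bool" where
  "binary_products C \<longleftrightarrow>
     (\<forall>A\<in>Obj C. \<forall>B\<in>Obj C.
        Prod C A B \<in> Obj C \<and>
        Pr1 C A B \<in> hom C (Prod C A B) A \<and> Pr2 C A B \<in> hom C (Prod C A B) B \<and>
        (\<forall>T. \<forall>f\<in>hom C T A. \<forall>g\<in>hom C T B.
           \<exists>!u. u \<in> hom C T (Prod C A B) \<and> Pr1 C A B \<cdot>\<^bsub>C\<^esub> u = f \<and> Pr2 C A B \<cdot>\<^bsub>C\<^esub> u = g))"

definition pair :: "('o, 'm, 'z) prod_cat_scheme \<Rightarrow> 'm \<Rightarrow> 'm \<Rightarrow> 'm" where
  "pair C f g = (THE u. u \<in> hom C (Dom C f) (Prod C (Cod C f) (Cod C g)) \<and>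
     Pr1 C (Cod C f) (Cod C g) \<cdot>\<^bsub>C\<^esub> u = f \<and> Pr2 C (Cod C f) (Cod C g) \<cdot>\<^bsub>C\<^esub> u = g)"

definition prod_map :: "('o, 'm, 'z) prod_cat_scheme \<Rightarrow> 'm \<Rightarrow> 'm \<Rightarrow> 'm" where
  "prod_map C f g =
     pair C (f \<cdot>\<^bsub>C\<^esub> Pr1 C (Dom C f) (Dom C g)) (g \<cdot>\<^bsub>C\<^esub> Pr2 C (Dom C f) (Dom C g))"

definition binary_coproducts :: "('o, 'm, 'z) prod_coprod_cat_scheme \<Rightarrow> bool" where
  "binary_coproducts C \<longleftrightarrow>
     (\<forall>A\<in>Obj C. \<forall>B\<in>Obj C.
        Coprod C A B \<in> Obj C \<and>
        In1 C A B \<in> hom C A (Coprod C A B) \<and> In2 C A B \<in> hom C B (Coprod C A B) \<and>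
        (\<forall>T. \<forall>f\<in>hom C A T. \<forall>g\<in>hom C B T.
           \<exists>!u. u \<in> hom C (Coprod C A B) T \<and> u \<cdot>\<^bsub>C\<^esub> In1 C A B = f \<and> u \<cdot>\<^bsub>C\<^esub> In2 C A B = g))"

definition copair :: "('o, 'm, 'z) prod_coprod_cat_scheme \<Rightarrow> 'm \<Rightarrow> 'm \<Rightarrow> 'm" where
  "copair C f g = (THE u. u \<in> hom C (Coprod C (Dom C f) (Dom C g)) (Cod C f) \<and>
     u \<cdot>\<^bsub>C\<^esub> In1 C (Dom C f) (Dom C g) = f \<and> u \<cdot>\<^bsub>C\<^esub> In2 C (Dom C f) (Dom C g) = g)"

definition coprod_map :: "('o, 'm, 'z) prod_coprod_cat_scheme \<Rightarrow> 'm \<Rightarrow> 'm \<Rightarrow> 'm" where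
  "coprod_map C f g =
     copair C (In1 C (Cod C f) (Cod C g) \<cdot>\<^bsub>C\<^esub> f) (In2 C (Cod C f) (Cod C g) \<cdot>\<^bsub>C\<^esub> g)"

text \<open>The comparison morphism $r_{A,B} \colon A + B \to A \times B$.\<close>

definition comparison :: "('o, 'm, 'z) prod_coprod_cat_scheme \<Rightarrow> 'o \<Rightarrow> 'o \<Rightarrow> 'm" where
  "comparison C A B =
     pair C (copair C (Ident C A) (zero_arr C B A)) (copair C (zero_arr C A B) (Ident C B))"

section \<open>Unital categories\<close>

definition jointly_extremal_epi :: "('o, 'm, 'z) cat_scheme \<Rightarrow> 'm \<Rightarrow> 'm \<Rightarrow> bool" where
  "jointly_extremal_epi C f g \<longleftrightarrow>
     f \<in> Arr C \<and> g \<in> Arr C \<and> Cod C f = Cod C g \<and>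
     (\<forall>m. monic C m \<and> Cod C m = Cod C f \<and>
        (\<exists>f'\<in>hom C (Dom C f) (Dom C m). m \<cdot>\<^bsub>C\<^esub> f' = f) \<and>
        (\<exists>g'\<in>hom C (Dom C g) (Dom C m). m \<cdot>\<^bsub>C\<^esub> g' = g) \<longrightarrow>
        isomorphism C m)"

definition unital_category :: "('o, 'm, 'z) prod_cat_scheme \<Rightarrow> bool" where
  "unital_category C \<longleftrightarrow>
     category C \<and> pointed C \<and> finitely_complete C \<and> binary_products C \<and>
     (\<forall>A\<in>Obj C. \<forall>B\<in>Obj C.
        jointly_extremal_epi C (pair C (Ident C A) (zero_arr C A B))
                               (pair C (zero_arr C B A) (Ident C B)))"

section \<open>Comonadic covers and natural imaginary splittings\<close>

record ('o, 'm) imaginary_cat = "('o, 'm) prod_coprod_cat" +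
  PObj :: "'o \<Rightarrow> 'o"
  PArr :: "'m \<Rightarrow> 'm"
  delta :: "'o \<Rightarrow> 'm"
  eps :: "'o \<Rightarrow> 'm"
  splitting :: "'o \<Rightarrow> 'o \<Rightarrow> 'm"

definition comonadic_covers :: "('o, 'm, 'z) imaginary_cat_scheme \<Rightarrow> bool" where
  "comonadic_covers C \<longleftrightarrow>
     is_functor C C (PObj C) (PArr C) \<and>
     (\<forall>X\<in>Obj C. delta C X \<in> hom C (PObj C X) (PObj C (PObj C X))) \<and>
     (\<forall>X\<in>Obj C. eps C X \<in> hom C (PObj C X) X) \<and>
     (\<forall>X Y. \<forall>f\<in>hom C X Y.
        delta C Y \<cdot>\<^bsub>C\<^esub> PArr C f = PArr C (PArr C f) \<cdot>\<^bsub>C\<^esub> delta C X) \<and>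
     (\<forall>X Y. \<forall>f\<in>hom C X Y. eps C Y \<cdot>\<^bsub>C\<^esub> PArr C f = f \<cdot>\<^bsub>C\<^esub> eps C X) \<and>
     (\<forall>X\<in>Obj C. eps C (PObj C X) \<cdot>\<^bsub>C\<^esub> delta C X = Ident C (PObj C X)) \<and>
     (\<forall>X\<in>Obj C. PArr C (eps C X) \<cdot>\<^bsub>C\<^esub> delta C X = Ident C (PObj C X)) \<and>
     (\<forall>X\<in>Obj C. delta C (PObj C X) \<cdot>\<^bsub>C\<^esub> delta C X
                = PArr C (delta C X) \<cdot>\<^bsub>C\<^esub> delta C X) \<and>
     (\<forall>X\<in>Obj C. regular_epi C (eps C X))"

definition natural_imaginary_splitting :: "('o, 'm, 'z) imaginary_cat_scheme \<Rightarrow> bool" where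
  "natural_imaginary_splitting C \<longleftrightarrow>
     (\<forall>A\<in>Obj C. \<forall>B\<in>Obj C.
        splitting C A B \<in> hom C (PObj C (Prod C A B)) (Coprod C A B)) \<and>
     (\<forall>A B A' B'. \<forall>a\<in>hom C A A'. \<forall>b\<in>hom C B B'.
        splitting C A' B' \<cdot>\<^bsub>C\<^esub> PArr C (prod_map C a b)
          = coprod_map C a b \<cdot>\<^bsub>C\<^esub> splitting C A B) \<and>
     (\<forall>A\<in>Obj C. \<forall>B\<in>Obj C.
        comparison C A B \<cdot>\<^bsub>C\<^esub> splitting C A B = eps C (Prod C A B))"

section \<open>Imaginary morphisms and intrinsic Schreier split epimorphisms\<close>

definition imag_hom :: "('o, 'm, 'z) imaginary_cat_scheme \<Rightarrow> 'o \<Rightarrow> 'o \<Rightarrow> 'm set" where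
  "imag_hom C X Y = hom C (PObj C X) Y"

text \<open>The imaginary domain \<open>A\<close> of \<open>a\<close> is an explicit argument, because it cannot be recovered
  from the domain of the underlying arrow unless \<open>P\<close> is injective on objects.\<close>

definition imag_comp :: "('o, 'm, 'z) imaginary_cat_scheme \<Rightarrow> 'o \<Rightarrow> 'm \<Rightarrow> 'm \<Rightarrow> 'm" where
  "imag_comp C A b a = b \<cdot>\<^bsub>C\<^esub> PArr C a \<cdot>\<^bsub>C\<^esub> delta C A"

definition real_arr :: "('o, 'm, 'z) imaginary_cat_scheme \<Rightarrow> 'm \<Rightarrow> 'm" where
  "real_arr C f = f \<cdot>\<^bsub>C\<^esub> eps C (Dom C f)"

definition imag_add :: "('o, 'm, 'z) imaginary_cat_scheme \<Rightarrow> 'o \<Rightarrow> 'm" where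
  "imag_add C X = copair C (Ident C X) (Ident C X) \<cdot>\<^bsub>C\<^esub> splitting C X X"

text \<open>In the last conjunct, precomposition with the real morphism $k \times s$ is
  precomposition with $P(k \times s)$.\<close>

definition intrinsic_schreier ::
  "('o, 'm, 'z) imaginary_cat_scheme \<Rightarrow> 'o \<Rightarrow> 'o \<Rightarrow> 'o \<Rightarrow> 'm \<Rightarrow> 'm \<Rightarrow> 'm \<Rightarrow> bool" where
  "intrinsic_schreier C K X Y k f s \<longleftrightarrow>
     f \<in> hom C X Y \<and> s \<in> hom C Y X \<and> f \<cdot>\<^bsub>C\<^esub> s = Ident C Y \<and>
     k \<in> hom C K X \<and> is_kernel C k f \<and>
     (\<exists>q\<in>imag_hom C X K.
        imag_comp C X (imag_add C X) (pair C (k \<cdot>\<^bsub>C\<^esub> q) (real_arr C (s \<cdot>\<^bsub>C\<^esub> f)))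
          = real_arr C (Ident C X) \<and>
        imag_comp C (Prod C X X) q (imag_add C X) \<cdot>\<^bsub>C\<^esub> PArr C (prod_map C k s)
          = real_arr C (Pr1 C K Y))"

end

theory Submission
  imports Defs
begin

text \<open>The idea is to calculate with elements, as one does for Schreier split extensions of
  monoids. An imaginary morphism \<open>T \<rightarrow> X\<close>, that is, an arrow \<open>P T \<rightarrow> X\<close>, is regarded as an
  element of \<open>X\<close>, and \<open>imag_plus\<close> adds such elements by means of the splitting. Real morphisms
  preserve this addition (\<open>comp_imag_plus\<close>) and the zero morphism is neutral on the right
  (\<open>imag_plus_zero\<close>), both by naturality of the splitting. The defining equations of the
  retraction \<open>q\<close> then read \<open>x = k (q x) + s (f x)\<close> and \<open>q (k a + s y) = a\<close>. Applying \<open>g\<close> to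
  \<open>x' = k' (q' x') + s' (f' x')\<close> gives \<open>g x' = k (\<gamma> (q' x')) + s (h (f' x'))\<close>, so that
  \<open>q (g x') = \<gamma> (q' x')\<close>: the retractions commute with every morphism of extensions
  (\<open>schreier_retraction_natural\<close>).

  Regular epimorphisms also become elementary: \<open>g\<close> is one iff it is surjective on imaginary
  elements, which amounts to an imaginary section, \<open>g \<sigma> = \<epsilon>\<close>. One direction is the projectivity of
  the values of \<open>P\<close>; the other one (\<open>regular_epi_of_imaginary_section\<close>) uses that the components
  of \<open>\<epsilon>\<close> are regular epimorphisms.

  The theorem is now read off. If \<open>\<gamma>\<close> and \<open>h\<close> are surjective, choose preimages of \<open>q x\<close> and
  \<open>f x\<close> and recombine them as \<open>k' a' + s' y'\<close>, which \<open>g\<close> maps to \<open>x\<close>. If \<open>g\<close> is surjective and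
  \<open>g x' = k a\<close>, then \<open>\<gamma> (q' x') = q (k a) = a\<close>; if \<open>g x' = s y\<close>, then \<open>h (f' x') = y\<close>. If \<open>\<gamma>\<close> and
  \<open>h\<close> are monic and \<open>g u = g v\<close>, then \<open>u\<close> and \<open>v\<close> have equal images under \<open>q'\<close> and \<open>f'\<close>, hence
  coincide. Conversely, if \<open>g\<close> is monic, then so are \<open>k \<gamma> = g k'\<close> and \<open>s h = g s'\<close>, because a
  kernel and a section are monic, and hence also \<open>\<gamma>\<close> and \<open>h\<close>.\<close>

section \<open>Composition, zero morphisms and monomorphisms\<close>

text \<open>The basic laws are restated with separate premises on arrows, domains and codomains, so
  that rewriting can discharge them without guessing intermediate objects; composites are
  normalized to the right.\<close>

context category
begin

lemma comp_arr [simp]: "f \<in> Arr C \<Longrightarrow> g \<in> Arr C \<Longrightarrow> Dom C g = Cod C f \<Longrightarrow> g \<cdot> f \<in> Arr C"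
  and dom_comp [simp]: "f \<in> Arr C \<Longrightarrow> g \<in> Arr C \<Longrightarrow> Dom C g = Cod C f \<Longrightarrow> Dom C (g \<cdot> f) = Dom C f"
  and cod_comp [simp]: "f \<in> Arr C \<Longrightarrow> g \<in> Arr C \<Longrightarrow> Dom C g = Cod C f \<Longrightarrow> Cod C (g \<cdot> f) = Cod C g"
  using comp_hom[of f "Dom C f" "Cod C f" g "Cod C g"] by (auto simp: hom_def)

lemma ident_arr [simp]: "A \<in> Obj C \<Longrightarrow> Ident C A \<in> Arr C"
  and dom_ident [simp]: "A \<in> Obj C \<Longrightarrow> Dom C (Ident C A) = A"
  and cod_ident [simp]: "A \<in> Obj C \<Longrightarrow> Cod C (Ident C A) = A"
  using ident_hom[of A] by (auto simp: hom_def)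

lemma comp_ident [simp]:
  "f \<in> Arr C \<Longrightarrow> Dom C f = A \<Longrightarrow> f \<cdot> Ident C A = f"
  "f \<in> Arr C \<Longrightarrow> Cod C f = B \<Longrightarrow> Ident C B \<cdot> f = f"
  by (auto intro: comp_ident_right comp_ident_left simp: hom_def)

lemma assoc_arr [simp]:
  "f \<in> Arr C \<Longrightarrow> g \<in> Arr C \<Longrightarrow> h \<in> Arr C \<Longrightarrow> Dom C g = Cod C f \<Longrightarrow> Dom C h = Cod C g
    \<Longrightarrow> (h \<cdot> g) \<cdot> f = h \<cdot> (g \<cdot> f)"
  using comp_assoc[of f "Dom C f" "Cod C f" g "Cod C g" h "Cod C h"] by (simp add: hom_def)

declare dom_obj [simp] cod_obj [simp]

lemma monic_cancel:
  "monic C m \<Longrightarrow> u \<in> hom C T (Dom C m) \<Longrightarrow> v \<in> hom C T (Dom C m) \<Longrightarrow> m \<cdot> u = m \<cdot> v \<Longrightarrow> u = v"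
  unfolding monic_def by blast

lemma monic_cancel_left:
  assumes "f \<in> hom C A B" "g \<in> hom C B D" "monic C (g \<cdot> f)"
  shows "monic C f"
proof -
  have "u = v" if "u \<in> hom C T A" "v \<in> hom C T A" "f \<cdot> u = f \<cdot> v" for T u v
    by (rule monic_cancel[of "g \<cdot> f" u T v]) (use that assms in \<open>auto simp: hom_def\<close>)
  thus ?thesis using assms by (auto simp: monic_def hom_def)
qed

lemma monic_comp:
  assumes "f \<in> hom C A B" "g \<in> hom C B D" "monic C f" "monic C g"
  shows "monic C (g \<cdot> f)"
proof -
  have "u = v" if "u \<in> hom C T A" "v \<in> hom C T A" "g \<cdot> (f \<cdot> u) = g \<cdot> (f \<cdot> v)" for T u v
  proof -
    have eq: "f \<cdot> u = f \<cdot> v"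
      by (rule monic_cancel[of g _ T]) (use that assms in \<open>auto simp: hom_def\<close>)
    show ?thesis
      by (rule monic_cancel[of f _ T]) (use that assms eq in \<open>auto simp: hom_def\<close>)
  qed
  thus ?thesis using assms by (auto simp: monic_def hom_def)
qed

lemma split_monic:
  assumes "s \<in> hom C Y X" "f \<in> hom C X Y" "f \<cdot> s = Ident C Y"
  shows "monic C s"
proof (rule monic_cancel_left[OF assms(1,2)])
  show "monic C (f \<cdot> s)"
    using assms by (auto simp: monic_def hom_def)
qed

lemma zero_arr_eq:
  assumes Z: "zero_object C Z" "u \<in> hom C A Z" "v \<in> hom C Z B"
  shows "zero_arr C A B = v \<cdot> u"
  unfolding zero_arr_def
proof (rule the_equality)
  show "\<exists>Z' u' v'. zero_object C Z' \<and> u' \<in> hom C A Z' \<and> v' \<in> hom C Z' B \<and> v \<cdot> u = v' \<cdot> u'"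
    using Z by blast
next
  fix z
  assume "\<exists>Z' u' v'. zero_object C Z' \<and> u' \<in> hom C A Z' \<and> v' \<in> hom C Z' B \<and> z = v' \<cdot> u'"
  then obtain Z' u' v' where Z': "zero_object C Z'" "u' \<in> hom C A Z'" "v' \<in> hom C Z' B"
    and z: "z = v' \<cdot> u'" by blast
  have obj: "A \<in> Obj C" "B \<in> Obj C" "Z \<in> Obj C" "Z' \<in> Obj C"
    using Z Z' dom_obj cod_obj by (auto simp: hom_def zero_object_def)
  then obtain i where i: "i \<in> hom C Z Z'"
    using Z(1) unfolding zero_object_def by blast
  \<comment> \<open>Both composites equal \<open>v' \<cdot> i \<cdot> u\<close>, for the unique map \<open>i\<close> between the two zero objects.\<close>
  have "i \<cdot> u = u'"
    using Z Z' i obj comp_hom[OF Z(2) i] unfolding zero_object_def by blast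
  moreover have "v' \<cdot> i = v"
    using Z Z' i obj comp_hom[OF i Z'(3)] unfolding zero_object_def by blast
  ultimately show "z = v \<cdot> u"
    using comp_assoc[OF Z(2) i Z'(3)] z by simp
qed

lemma zero_arr_factor:
  assumes "pointed C" "A \<in> Obj C" "B \<in> Obj C"
  obtains Z u v where "zero_object C Z" "u \<in> hom C A Z" "v \<in> hom C Z B" "zero_arr C A B = v \<cdot> u"
proof -
  obtain Z where Z: "zero_object C Z" using assms(1) by (auto simp: pointed_def)
  have "\<exists>u. u \<in> hom C A Z" "\<exists>v. v \<in> hom C Z B"
    using Z assms(2,3) unfolding zero_object_def by (meson ex1_implies_ex)+
  then obtain u v where uv: "u \<in> hom C A Z" "v \<in> hom C Z B" by blast
  show thesis by (rule that[OF Z uv zero_arr_eq[OF Z uv]])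
qed

lemma zero_arr_hom:
  assumes "pointed C" "A \<in> Obj C" "B \<in> Obj C"
  shows "zero_arr C A B \<in> hom C A B"
  by (rule zero_arr_factor[OF assms]) (auto intro: comp_hom)

lemma comp_zero_arr:
  assumes "pointed C" "A \<in> Obj C" "g \<in> hom C B D"
  shows "g \<cdot> zero_arr C A B = zero_arr C A D"
proof -
  have "B \<in> Obj C" using assms dom_obj by (auto simp: hom_def)
  then obtain Z u v where Z: "zero_object C Z" "u \<in> hom C A Z" "v \<in> hom C Z B"
    "zero_arr C A B = v \<cdot> u" by (rule zero_arr_factor[OF assms(1,2)])
  have "zero_arr C A D = (g \<cdot> v) \<cdot> u"
    by (rule zero_arr_eq[OF Z(1,2) comp_hom[OF Z(3) assms(3)]])
  thus ?thesis using Z comp_assoc[OF Z(2,3) assms(3)] by simp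
qed

lemma zero_arr_comp:
  assumes "pointed C" "D \<in> Obj C" "f \<in> hom C A B"
  shows "zero_arr C B D \<cdot> f = zero_arr C A D"
proof -
  have "B \<in> Obj C" using assms cod_obj by (auto simp: hom_def)
  then obtain Z u v where Z: "zero_object C Z" "u \<in> hom C B Z" "v \<in> hom C Z D"
    "zero_arr C B D = v \<cdot> u" by (rule zero_arr_factor[OF assms(1) _ assms(2)])
  have "zero_arr C A D = v \<cdot> (u \<cdot> f)"
    by (rule zero_arr_eq[OF Z(1) comp_hom[OF assms(3) Z(2)] Z(3)])
  thus ?thesis using Z comp_assoc[OF assms(3) Z(2,3)] by simp
qed

lemma kernel_monic:
  assumes "pointed C" and k: "is_kernel C k f"
  shows "monic C k"
proof -
  have "u = v" if uv: "u \<in> hom C T (Dom C k)" "v \<in> hom C T (Dom C k)" "k \<cdot> u = k \<cdot> v" for T u v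
  proof -
    have fk: "f \<in> Arr C" "k \<in> Arr C" "Cod C k = Dom C f"
      "f \<cdot> k = zero_arr C (Dom C k) (Cod C f)"
      using k by (auto simp: is_kernel_def)
    have kernel_lift: "\<And>a. a \<in> hom C T (Dom C f) \<Longrightarrow> f \<cdot> a = zero_arr C T (Cod C f)
        \<Longrightarrow> \<exists>!w. w \<in> hom C T (Dom C k) \<and> k \<cdot> w = a"
      using k unfolding is_kernel_def by blast
    have "f \<cdot> (k \<cdot> u) = (f \<cdot> k) \<cdot> u" using fk(1-3) uv(1) by (simp add: hom_def)
    also have "\<dots> = zero_arr C T (Cod C f)"
      unfolding fk(4) by (rule zero_arr_comp) (use assms(1) fk uv in auto)
    finally have "f \<cdot> (k \<cdot> u) = zero_arr C T (Cod C f)" .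
    moreover have "k \<cdot> u \<in> hom C T (Dom C f)"
      by (rule comp_hom[OF uv(1)]) (use fk in \<open>simp add: hom_def\<close>)
    ultimately have "\<exists>!w. w \<in> hom C T (Dom C k) \<and> k \<cdot> w = k \<cdot> u"
      using kernel_lift by blast
    thus ?thesis using uv by metis
  qed
  moreover have "k \<in> Arr C" using k by (simp add: is_kernel_def)
  ultimately show ?thesis unfolding monic_def by blast
qed

lemma regular_epi_cancel:
  assumes "regular_epi C e" "u \<in> hom C (Cod C e) D" "v \<in> hom C (Cod C e) D" "u \<cdot> e = v \<cdot> e"
  shows "u = v"
proof -
  obtain a b where ab: "is_coequalizer C e a b"
    using assms(1) by (auto simp: regular_epi_def)
  have "u \<cdot> e \<in> hom C (Dom C e) D" "u \<cdot> e \<cdot> a = u \<cdot> e \<cdot> b"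
    using ab assms by (auto simp: is_coequalizer_def hom_def)
  thus ?thesis
    using ab assms unfolding is_coequalizer_def by metis
qed

end

section \<open>Weak kernel pairs\<close>

text \<open>The arrows 0, 1, 2 are the identities, 3 goes from 0 to 2 and 4 from 1 to 2. Composites of
  arrows that do not match have arbitrary values.\<close>
definition cospan_shape :: "(nat, nat) cat" where
  "cospan_shape = \<lparr>Obj = {0, 1, 2}, Arr = {0, 1, 2, 3, 4},
     Dom = (\<lambda>a. if a = 3 then 0 else if a = 4 then 1 else a),
     Cod = (\<lambda>a. if a = 3 \<or> a = 4 then 2 else a),
     Ident = (\<lambda>i. i),
     Comp = (\<lambda>b a. if a = 3 \<or> a = 4 then a else b)\<rparr>"

lemma category_cospan_shape: "category cospan_shape"
  by unfold_locales (auto simp: cospan_shape_def hom_def)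

context category
begin

text \<open>Only the existence half of the universal property is recorded: to exhibit \<open>f\<close> as a
  coequalizer of \<open>p1\<close> and \<open>p2\<close> it suffices that every pair identified by \<open>f\<close> comes from them.\<close>
lemma weak_kernel_pair:
  assumes "finitely_complete C" and f: "f \<in> hom C X Y"
  shows "\<exists>R. \<exists>p1\<in>hom C R X. \<exists>p2\<in>hom C R X. f \<cdot> p1 = f \<cdot> p2 \<and>
    (\<forall>T. \<forall>a\<in>hom C T X. \<forall>b\<in>hom C T X. f \<cdot> a = f \<cdot> b
       \<longrightarrow> (\<exists>w\<in>hom C T R. p1 \<cdot> w = a \<and> p2 \<cdot> w = b))"
proof -
  define Fo where "Fo = (\<lambda>i::nat. if i = 2 then Y else X)"
  define Fm where "Fm = (\<lambda>a::nat. if a = 3 \<or> a = 4 then f else Ident C (Fo a))"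
  have "is_functor cospan_shape C Fo Fm"
    using f by (auto simp: is_functor_def cospan_shape_def hom_def Fo_def Fm_def)
  then obtain R l where lim: "is_limit cospan_shape C Fo Fm R l"
    using assms(1) category_cospan_shape unfolding finitely_complete_def
    by (metis (no_types, lifting) cospan_shape_def finite.intros cat.select_convs(1,2))
  have l: "l 0 \<in> hom C R X" "l 1 \<in> hom C R X" "f \<cdot> l 0 = f \<cdot> l 1"
    using lim by (auto simp: is_limit_def is_cone_def cospan_shape_def Fo_def Fm_def)
  have "\<exists>w\<in>hom C T R. l 0 \<cdot> w = a \<and> l 1 \<cdot> w = b"
    if ab: "a \<in> hom C T X" "b \<in> hom C T X" "f \<cdot> a = f \<cdot> b" for T a b
  proof -
    define l' where "l' = (\<lambda>i::nat. if i = 0 then a else if i = 1 then b else f \<cdot> a)"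
    have "is_cone cospan_shape C Fo Fm T l'"
      using ab f by (auto simp: is_cone_def cospan_shape_def hom_def Fo_def Fm_def l'_def)
    then obtain w where "w \<in> hom C T R" "\<forall>i\<in>Obj cospan_shape. l i \<cdot> w = l' i"
      using lim unfolding is_limit_def by blast
    thus ?thesis by (auto simp: cospan_shape_def l'_def)
  qed
  with l show ?thesis by blast
qed

end

section \<open>Products, coproducts and the comonad\<close>

locale imaginary_splitting = category C
  for C :: "('o, 'm, 'z) imaginary_cat_scheme" (structure) +
  assumes pointed: "pointed C"
    and finitely_complete: "finitely_complete C"
    and products: "binary_products C"
    and coproducts: "binary_coproducts C"
    and covers: "comonadic_covers C"
    and splitting: "natural_imaginary_splitting C"
begin

lemma pair_eqs:
  assumes "f \<in> Arr C" "g \<in> Arr C" "Dom C g = Dom C f"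
  shows pair_arr [simp]: "pair C f g \<in> Arr C"
    and dom_pair [simp]: "Dom C (pair C f g) = Dom C f"
    and cod_pair [simp]: "Cod C (pair C f g) = Prod C (Cod C f) (Cod C g)"
    and pr1_pair [simp]: "Cod C f = A \<Longrightarrow> Cod C g = B \<Longrightarrow> Pr1 C A B \<cdot> pair C f g = f"
    and pr2_pair [simp]: "Cod C f = A \<Longrightarrow> Cod C g = B \<Longrightarrow> Pr2 C A B \<cdot> pair C f g = g"
proof -
  let ?P = "\<lambda>u. u \<in> hom C (Dom C f) (Prod C (Cod C f) (Cod C g)) \<and>
     Pr1 C (Cod C f) (Cod C g) \<cdot> u = f \<and> Pr2 C (Cod C f) (Cod C g) \<cdot> u = g"
  have "\<exists>!u. ?P u"
    using products assms unfolding binary_products_def by (simp add: hom_def)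
  hence *: "?P (pair C f g)" unfolding pair_def by (rule theI')
  show "pair C f g \<in> Arr C" "Dom C (pair C f g) = Dom C f"
    "Cod C (pair C f g) = Prod C (Cod C f) (Cod C g)"
    "Cod C f = A \<Longrightarrow> Cod C g = B \<Longrightarrow> Pr1 C A B \<cdot> pair C f g = f"
    "Cod C f = A \<Longrightarrow> Cod C g = B \<Longrightarrow> Pr2 C A B \<cdot> pair C f g = g"
    using * by (auto simp: hom_def)
qed

lemma pr_typing [simp]:
  assumes "A \<in> Obj C" "B \<in> Obj C"
  shows "Prod C A B \<in> Obj C"
    "Pr1 C A B \<in> Arr C" "Dom C (Pr1 C A B) = Prod C A B" "Cod C (Pr1 C A B) = A"
    "Pr2 C A B \<in> Arr C" "Dom C (Pr2 C A B) = Prod C A B" "Cod C (Pr2 C A B) = B"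
  using products assms unfolding binary_products_def by (auto simp: hom_def)

lemma pr_pair_comp [simp]:
  assumes "f \<in> Arr C" "g \<in> Arr C" "Dom C g = Dom C f" "x \<in> Arr C" "Cod C x = Dom C f"
    "Cod C f = A" "Cod C g = B"
  shows "Pr1 C A B \<cdot> (pair C f g \<cdot> x) = f \<cdot> x" "Pr2 C A B \<cdot> (pair C f g \<cdot> x) = g \<cdot> x"
  using assms by (auto simp del: assoc_arr simp: assoc_arr[symmetric])

lemma product_ext:
  assumes "u \<in> hom C T (Prod C A B)" "v \<in> hom C T (Prod C A B)" "A \<in> Obj C" "B \<in> Obj C"
    "Pr1 C A B \<cdot> u = Pr1 C A B \<cdot> v" "Pr2 C A B \<cdot> u = Pr2 C A B \<cdot> v"
  shows "u = v"
proof -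
  have "Pr1 C A B \<cdot> v \<in> hom C T A" "Pr2 C A B \<cdot> v \<in> hom C T B"
    using assms by (auto simp: hom_def)
  hence "\<exists>!w. w \<in> hom C T (Prod C A B) \<and> Pr1 C A B \<cdot> w = Pr1 C A B \<cdot> v
      \<and> Pr2 C A B \<cdot> w = Pr2 C A B \<cdot> v"
    using products assms(3,4) unfolding binary_products_def by blast
  thus ?thesis using assms by blast
qed

lemma pair_comp [simp]:
  assumes "f \<in> Arr C" "g \<in> Arr C" "Dom C g = Dom C f" "x \<in> Arr C" "Cod C x = Dom C f"
  shows "pair C f g \<cdot> x = pair C (f \<cdot> x) (g \<cdot> x)"
  by (rule product_ext[of _ "Dom C x" "Cod C f" "Cod C g"]) (use assms in \<open>auto simp: hom_def\<close>)

lemma prod_map_typing [simp]: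
  assumes "f \<in> Arr C" "g \<in> Arr C"
  shows "prod_map C f g \<in> Arr C" "Dom C (prod_map C f g) = Prod C (Dom C f) (Dom C g)"
    "Cod C (prod_map C f g) = Prod C (Cod C f) (Cod C g)"
  using assms by (auto simp: prod_map_def)

lemma prod_map_pair [simp]:
  assumes "f \<in> Arr C" "g \<in> Arr C" "a \<in> Arr C" "b \<in> Arr C" "Dom C b = Dom C a"
    "Dom C f = Cod C a" "Dom C g = Cod C b"
  shows "prod_map C f g \<cdot> pair C a b = pair C (f \<cdot> a) (g \<cdot> b)"
  using assms by (simp add: prod_map_def)

lemma copair_eqs:
  assumes "f \<in> Arr C" "g \<in> Arr C" "Cod C g = Cod C f"
  shows copair_arr [simp]: "copair C f g \<in> Arr C"
    and dom_copair [simp]: "Dom C (copair C f g) = Coprod C (Dom C f) (Dom C g)"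
    and cod_copair [simp]: "Cod C (copair C f g) = Cod C f"
    and copair_in1 [simp]: "Dom C f = A \<Longrightarrow> Dom C g = B \<Longrightarrow> copair C f g \<cdot> In1 C A B = f"
    and copair_in2 [simp]: "Dom C f = A \<Longrightarrow> Dom C g = B \<Longrightarrow> copair C f g \<cdot> In2 C A B = g"
proof -
  let ?P = "\<lambda>u. u \<in> hom C (Coprod C (Dom C f) (Dom C g)) (Cod C f) \<and>
     u \<cdot> In1 C (Dom C f) (Dom C g) = f \<and> u \<cdot> In2 C (Dom C f) (Dom C g) = g"
  have "\<exists>!u. ?P u"
    using coproducts assms unfolding binary_coproducts_def by (simp add: hom_def)
  hence *: "?P (copair C f g)" unfolding copair_def by (rule theI')
  show "copair C f g \<in> Arr C" "Dom C (copair C f g) = Coprod C (Dom C f) (Dom C g)"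
    "Cod C (copair C f g) = Cod C f"
    "Dom C f = A \<Longrightarrow> Dom C g = B \<Longrightarrow> copair C f g \<cdot> In1 C A B = f"
    "Dom C f = A \<Longrightarrow> Dom C g = B \<Longrightarrow> copair C f g \<cdot> In2 C A B = g"
    using * by (auto simp: hom_def)
qed

lemma in_typing [simp]:
  assumes "A \<in> Obj C" "B \<in> Obj C"
  shows "Coprod C A B \<in> Obj C"
    "In1 C A B \<in> Arr C" "Dom C (In1 C A B) = A" "Cod C (In1 C A B) = Coprod C A B"
    "In2 C A B \<in> Arr C" "Dom C (In2 C A B) = B" "Cod C (In2 C A B) = Coprod C A B"
  using coproducts assms unfolding binary_coproducts_def by (auto simp: hom_def)

lemma copair_in_comp [simp]:
  assumes "f \<in> Arr C" "g \<in> Arr C" "Cod C g = Cod C f" "Dom C f = A" "Dom C g = B" "x \<in> Arr C"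
  shows "Cod C x = A \<Longrightarrow> copair C f g \<cdot> (In1 C A B \<cdot> x) = f \<cdot> x"
    "Cod C x = B \<Longrightarrow> copair C f g \<cdot> (In2 C A B \<cdot> x) = g \<cdot> x"
  using assms by (auto simp del: assoc_arr simp: assoc_arr[symmetric])

lemma coproduct_ext:
  assumes "u \<in> hom C (Coprod C A B) T" "v \<in> hom C (Coprod C A B) T" "A \<in> Obj C" "B \<in> Obj C"
    "u \<cdot> In1 C A B = v \<cdot> In1 C A B" "u \<cdot> In2 C A B = v \<cdot> In2 C A B"
  shows "u = v"
proof -
  have "v \<cdot> In1 C A B \<in> hom C A T" "v \<cdot> In2 C A B \<in> hom C B T"
    using assms by (auto simp: hom_def)
  hence "\<exists>!w. w \<in> hom C (Coprod C A B) T \<and> w \<cdot> In1 C A B = v \<cdot> In1 C A B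
      \<and> w \<cdot> In2 C A B = v \<cdot> In2 C A B"
    using coproducts assms(3,4) unfolding binary_coproducts_def by blast
  thus ?thesis using assms by blast
qed

lemma comp_copair [simp]:
  assumes "f \<in> Arr C" "g \<in> Arr C" "Cod C g = Cod C f" "x \<in> Arr C" "Dom C x = Cod C f"
  shows "x \<cdot> copair C f g = copair C (x \<cdot> f) (x \<cdot> g)"
  by (rule coproduct_ext[of _ "Dom C f" "Dom C g" "Cod C x"]) (use assms in \<open>auto simp: hom_def\<close>)

lemma coprod_map_typing [simp]:
  assumes "f \<in> Arr C" "g \<in> Arr C"
  shows "coprod_map C f g \<in> Arr C" "Dom C (coprod_map C f g) = Coprod C (Dom C f) (Dom C g)"
    "Cod C (coprod_map C f g) = Coprod C (Cod C f) (Cod C g)"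
  using assms by (auto simp: coprod_map_def)

lemma copair_coprod_map [simp]:
  assumes "f \<in> Arr C" "g \<in> Arr C" "a \<in> Arr C" "b \<in> Arr C" "Cod C b = Cod C a"
    "Cod C f = Dom C a" "Cod C g = Dom C b"
  shows "copair C a b \<cdot> coprod_map C f g = copair C (a \<cdot> f) (b \<cdot> g)"
  using assms by (simp add: coprod_map_def)

lemma P_typing [simp]:
  "A \<in> Obj C \<Longrightarrow> PObj C A \<in> Obj C"
  "f \<in> Arr C \<Longrightarrow> PArr C f \<in> Arr C"
  "f \<in> Arr C \<Longrightarrow> Dom C (PArr C f) = PObj C (Dom C f)"
  "f \<in> Arr C \<Longrightarrow> Cod C (PArr C f) = PObj C (Cod C f)"
  "A \<in> Obj C \<Longrightarrow> PArr C (Ident C A) = Ident C (PObj C A)"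
  "A \<in> Obj C \<Longrightarrow> eps C A \<in> Arr C"
  "A \<in> Obj C \<Longrightarrow> Dom C (eps C A) = PObj C A"
  "A \<in> Obj C \<Longrightarrow> Cod C (eps C A) = A"
  "A \<in> Obj C \<Longrightarrow> delta C A \<in> Arr C"
  "A \<in> Obj C \<Longrightarrow> Dom C (delta C A) = PObj C A"
  "A \<in> Obj C \<Longrightarrow> Cod C (delta C A) = PObj C (PObj C A)"
  "A \<in> Obj C \<Longrightarrow> B \<in> Obj C \<Longrightarrow> splitting C A B \<in> Arr C"
  "A \<in> Obj C \<Longrightarrow> B \<in> Obj C \<Longrightarrow> Dom C (splitting C A B) = PObj C (Prod C A B)"
  "A \<in> Obj C \<Longrightarrow> B \<in> Obj C \<Longrightarrow> Cod C (splitting C A B) = Coprod C A B"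
  using covers splitting
  by (auto simp: comonadic_covers_def is_functor_def natural_imaginary_splitting_def hom_def)

lemma P_comp [simp]:
  "f \<in> Arr C \<Longrightarrow> g \<in> Arr C \<Longrightarrow> Dom C g = Cod C f \<Longrightarrow> PArr C (g \<cdot> f) = PArr C g \<cdot> PArr C f"
  using covers by (auto simp: comonadic_covers_def is_functor_def)

lemma eps_natural [simp]:
  "f \<in> Arr C \<Longrightarrow> Cod C f = Y \<Longrightarrow> eps C Y \<cdot> PArr C f = f \<cdot> eps C (Dom C f)"
  using covers by (auto simp: comonadic_covers_def hom_def)

lemma delta_natural [simp]:
  "f \<in> Arr C \<Longrightarrow> Cod C f = Y \<Longrightarrow> delta C Y \<cdot> PArr C f = PArr C (PArr C f) \<cdot> delta C (Dom C f)"
  using covers by (auto simp: comonadic_covers_def hom_def)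

lemma comonad_laws [simp]:
  "X \<in> Obj C \<Longrightarrow> eps C (PObj C X) \<cdot> delta C X = Ident C (PObj C X)"
  "X \<in> Obj C \<Longrightarrow> PArr C (eps C X) \<cdot> delta C X = Ident C (PObj C X)"
  "X \<in> Obj C \<Longrightarrow> delta C (PObj C X) \<cdot> delta C X = PArr C (delta C X) \<cdot> delta C X"
  using covers by (auto simp: comonadic_covers_def)

lemma regular_epi_eps: "X \<in> Obj C \<Longrightarrow> regular_epi C (eps C X)"
  using covers by (auto simp: comonadic_covers_def)

text \<open>As composites associate to the right, naturality is also needed in front of a further
  arrow.\<close>
lemma eps_natural_comp [simp]:
  assumes "f \<in> Arr C" "Cod C f = Y" "x \<in> Arr C" "Cod C x = PObj C (Dom C f)"
  shows "eps C Y \<cdot> (PArr C f \<cdot> x) = f \<cdot> (eps C (Dom C f) \<cdot> x)"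
proof -
  have "(eps C Y \<cdot> PArr C f) \<cdot> x = (f \<cdot> eps C (Dom C f)) \<cdot> x" using assms by (simp del: assoc_arr)
  thus ?thesis using assms by (auto simp del: eps_natural)
qed

lemma delta_natural_comp [simp]:
  assumes "f \<in> Arr C" "Cod C f = Y" "x \<in> Arr C" "Cod C x = PObj C (Dom C f)"
  shows "delta C Y \<cdot> (PArr C f \<cdot> x) = PArr C (PArr C f) \<cdot> (delta C (Dom C f) \<cdot> x)"
proof -
  have "(delta C Y \<cdot> PArr C f) \<cdot> x = (PArr C (PArr C f) \<cdot> delta C (Dom C f)) \<cdot> x"
    using assms by (simp del: assoc_arr)
  thus ?thesis using assms by (auto simp del: delta_natural)
qed

lemma splitting_natural:
  assumes "a \<in> Arr C" "b \<in> Arr C"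
  shows "splitting C (Cod C a) (Cod C b) \<cdot> PArr C (prod_map C a b)
    = coprod_map C a b \<cdot> splitting C (Dom C a) (Dom C b)"
  using splitting assms by (auto simp: natural_imaginary_splitting_def hom_def)

lemma comparison_splitting:
  "A \<in> Obj C \<Longrightarrow> B \<in> Obj C \<Longrightarrow> comparison C A B \<cdot> splitting C A B = eps C (Prod C A B)"
  using splitting by (auto simp: natural_imaginary_splitting_def)


section \<open>Regular epimorphisms and imaginary sections\<close>

text \<open>The arrow \<open>f\<close> is the coequalizer of its weak kernel pair. For a competitor \<open>j\<close>, the
  factorization \<open>w\<close> has to satisfy \<open>w \<epsilon> = j \<sigma>\<close>, because \<open>f \<sigma> = \<epsilon>\<close>; such a \<open>w\<close> exists because
  \<open>\<epsilon>\<close> is a coequalizer. That \<open>w f = j\<close> may be checked after precomposition with \<open>\<epsilon>\<close>, where it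
  holds because \<open>f\<close> identifies \<open>\<epsilon>\<close> with \<open>\<sigma> P(f)\<close>, so \<open>j\<close> does as well.\<close>
lemma regular_epi_of_imaginary_section:
  assumes f: "f \<in> hom C X Y" and \<sigma>: "\<sigma> \<in> imag_hom C Y X" and sec: "f \<cdot> \<sigma> = eps C Y"
  shows "regular_epi C f"
proof -
  have obj: "X \<in> Obj C" "Y \<in> Obj C" using f by (auto simp: hom_def)
  obtain R p1 p2 where p: "p1 \<in> hom C R X" "p2 \<in> hom C R X" "f \<cdot> p1 = f \<cdot> p2"
    and R: "\<And>T a b. a \<in> hom C T X \<Longrightarrow> b \<in> hom C T X \<Longrightarrow> f \<cdot> a = f \<cdot> b
       \<Longrightarrow> \<exists>w\<in>hom C T R. p1 \<cdot> w = a \<and> p2 \<cdot> w = b"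
    using weak_kernel_pair[OF finitely_complete f] by metis
  obtain u v where uv: "is_coequalizer C (eps C Y) u v"
    using regular_epi_eps[OF obj(2)] by (auto simp: regular_epi_def)
  have "\<exists>!w. w \<in> hom C Y D \<and> w \<cdot> f = j"
    if j: "j \<in> hom C X D" "j \<cdot> p1 = j \<cdot> p2" for D j
  proof -
    have uvt: "u \<in> Arr C" "v \<in> Arr C" "Dom C v = Dom C u" "Cod C v = PObj C Y"
      "Cod C u = PObj C Y" "eps C Y \<cdot> u = eps C Y \<cdot> v"
      using uv obj by (auto simp: is_coequalizer_def hom_def)
    have \<sigma>t: "\<sigma> \<in> Arr C" "Dom C \<sigma> = PObj C Y" "Cod C \<sigma> = X"
      using \<sigma> by (auto simp: imag_hom_def hom_def)
    have ft: "f \<in> Arr C" "Dom C f = X" "Cod C f = Y" using f by (auto simp: hom_def)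
    have "f \<cdot> (\<sigma> \<cdot> u) = (f \<cdot> \<sigma>) \<cdot> u" "f \<cdot> (\<sigma> \<cdot> v) = (f \<cdot> \<sigma>) \<cdot> v"
      using ft \<sigma>t uvt by auto
    hence "f \<cdot> (\<sigma> \<cdot> u) = f \<cdot> (\<sigma> \<cdot> v)" unfolding sec using uvt by simp
    then obtain w0 where w0: "w0 \<in> hom C (Dom C u) R" "p1 \<cdot> w0 = \<sigma> \<cdot> u" "p2 \<cdot> w0 = \<sigma> \<cdot> v"
      using R[of "\<sigma> \<cdot> u" "Dom C u" "\<sigma> \<cdot> v"] \<sigma>t uvt by (auto simp: hom_def)
    have "(j \<cdot> p1) \<cdot> w0 = (j \<cdot> p2) \<cdot> w0" using j by simp
    hence "j \<cdot> (p1 \<cdot> w0) = j \<cdot> (p2 \<cdot> w0)" using j(1) p w0 by (simp add: hom_def)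
    hence "(j \<cdot> \<sigma>) \<cdot> u = (j \<cdot> \<sigma>) \<cdot> v" using w0 j(1) \<sigma>t uvt by (simp add: hom_def)
    moreover have "j \<cdot> \<sigma> \<in> hom C (Dom C (eps C Y)) D"
      using j(1) \<sigma>t obj by (simp add: hom_def)
    ultimately obtain w where w: "w \<in> hom C Y D" "w \<cdot> eps C Y = j \<cdot> \<sigma>"
      using uv obj unfolding is_coequalizer_def by (metis P_typing(8))
    have jt: "j \<in> Arr C" "Dom C j = X" "Cod C j = D" and wt: "w \<in> Arr C" "Dom C w = Y" "Cod C w = D"
      using j w by (auto simp: hom_def)
    have "f \<cdot> (\<sigma> \<cdot> PArr C f) = (f \<cdot> \<sigma>) \<cdot> PArr C f" using ft \<sigma>t by simp
    also have "\<dots> = f \<cdot> eps C X" unfolding sec using ft by simp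
    finally obtain w1 where w1: "w1 \<in> hom C (PObj C X) R" "p1 \<cdot> w1 = eps C X"
      "p2 \<cdot> w1 = \<sigma> \<cdot> PArr C f"
      using R[of "eps C X" "PObj C X" "\<sigma> \<cdot> PArr C f"] ft \<sigma>t obj by (auto simp: hom_def)
    have "(j \<cdot> p1) \<cdot> w1 = (j \<cdot> p2) \<cdot> w1" using j by simp
    hence "j \<cdot> (p1 \<cdot> w1) = j \<cdot> (p2 \<cdot> w1)" using j(1) p w1 by (simp add: hom_def)
    hence "j \<cdot> eps C X = (j \<cdot> \<sigma>) \<cdot> PArr C f" using w1 jt ft \<sigma>t by simp
    also have "\<dots> = (w \<cdot> f) \<cdot> eps C X" unfolding w(2)[symmetric] using wt ft obj by simp
    finally have "j = w \<cdot> f"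
      using regular_epi_cancel[OF regular_epi_eps[OF obj(1)], of j D "w \<cdot> f"] jt wt ft obj
      by (simp add: hom_def)
    moreover have "w' = w" if w': "w' \<in> hom C Y D" "w' \<cdot> f = j" for w'
    proof -
      have "w' \<cdot> (f \<cdot> \<sigma>) = (w' \<cdot> f) \<cdot> \<sigma>" using w'(1) ft \<sigma>t by (simp add: hom_def)
      hence "w' \<cdot> eps C Y = w \<cdot> eps C Y" using w' sec w by simp
      thus ?thesis
        using regular_epi_cancel[OF regular_epi_eps[OF obj(2)], of w' D w] w' w obj by simp
    qed
    ultimately show ?thesis using w by blast
  qed
  hence "is_coequalizer C f p1 p2"
    using f p by (auto simp: is_coequalizer_def hom_def)
  thus ?thesis by (auto simp: regular_epi_def)
qed

lemma imaginary_section_of_regular_epi: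
  assumes "regular_epi C f" "f \<in> hom C X Y" "projective C (PObj C Y)"
  obtains \<sigma> where "\<sigma> \<in> imag_hom C Y X" "f \<cdot> \<sigma> = eps C Y"
proof -
  have "Y \<in> Obj C" using assms(2) by (auto simp: hom_def)
  hence "eps C Y \<in> hom C (PObj C Y) (Cod C f)" using assms(2) by (auto simp: hom_def)
  thus thesis using assms that unfolding projective_def imag_hom_def
    by (metis (mono_tags, lifting) hom_def mem_Collect_eq)
qed

end

section \<open>Adding imaginary morphisms\<close>

text \<open>The sum of two imaginary elements of \<open>X\<close> defined over \<open>T\<close>. The object \<open>T\<close> is an argument
  for the same reason as in the composition of imaginary morphisms.\<close>
definition imag_plus :: "('o, 'm, 'z) imaginary_cat_scheme \<Rightarrow> 'o \<Rightarrow> 'm \<Rightarrow> 'm \<Rightarrow> 'm" where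
  "imag_plus C T a b = imag_comp C T (imag_add C (Cod C a)) (pair C a b)"

context imaginary_splitting
begin

lemma zero_arr_simps [simp]:
  assumes "A \<in> Obj C" "B \<in> Obj C"
  shows "zero_arr C A B \<in> Arr C" "Dom C (zero_arr C A B) = A" "Cod C (zero_arr C A B) = B"
  using zero_arr_hom[OF pointed assms] by (auto simp: hom_def)

lemma imag_add_typing [simp]:
  assumes "X \<in> Obj C"
  shows "imag_add C X \<in> Arr C" "Dom C (imag_add C X) = PObj C (Prod C X X)"
    "Cod C (imag_add C X) = X"
  using assms by (auto simp: imag_add_def)

lemma imag_add_natural:
  assumes g: "g \<in> hom C X Y"
  shows "imag_add C Y \<cdot> PArr C (prod_map C g g) = g \<cdot> imag_add C X"
proof -
  have t: "g \<in> Arr C" "Dom C g = X" "Cod C g = Y" "X \<in> Obj C" "Y \<in> Obj C"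
    using g by (auto simp: hom_def)
  have "imag_add C Y \<cdot> PArr C (prod_map C g g)
      = copair C (Ident C Y) (Ident C Y) \<cdot> (splitting C Y Y \<cdot> PArr C (prod_map C g g))"
    using t by (simp add: imag_add_def)
  also have "splitting C Y Y \<cdot> PArr C (prod_map C g g) = coprod_map C g g \<cdot> splitting C X X"
    using splitting_natural[of g g] t by simp
  also have "copair C (Ident C Y) (Ident C Y) \<cdot> (coprod_map C g g \<cdot> splitting C X X)
      = (copair C (Ident C Y) (Ident C Y) \<cdot> coprod_map C g g) \<cdot> splitting C X X"
    using t by (simp del: copair_coprod_map)
  also have "\<dots> = (g \<cdot> copair C (Ident C X) (Ident C X)) \<cdot> splitting C X X"
    using t by (simp del: assoc_arr)
  finally show ?thesis using t by (simp add: imag_add_def del: comp_copair)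
qed

text \<open>Writing \<open>\<langle>1,0\<rangle>\<close> as \<open>(1 \<times> 0) \<langle>1,1\<rangle>\<close> lets naturality move \<open>1 \<times> 0\<close> past the splitting, where
  it turns the codiagonal into \<open>(1 0) = \<pi>\<^sub>1 r\<close>. The equation \<open>r t = \<epsilon>\<close> then applies.\<close>
lemma imag_add_right_zero:
  assumes X: "X \<in> Obj C"
  shows "imag_add C X \<cdot> PArr C (pair C (Ident C X) (zero_arr C X X)) = eps C X"
proof -
  let ?i = "Ident C X" and ?z = "zero_arr C X X"
  have "pair C ?i ?z = prod_map C ?i ?z \<cdot> pair C ?i ?i"
    using X by simp
  hence "imag_add C X \<cdot> PArr C (pair C ?i ?z)
      = copair C ?i ?i \<cdot> ((splitting C X X \<cdot> PArr C (prod_map C ?i ?z)) \<cdot> PArr C (pair C ?i ?i))"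
    using X by (simp add: imag_add_def del: prod_map_pair)
  also have "splitting C X X \<cdot> PArr C (prod_map C ?i ?z) = coprod_map C ?i ?z \<cdot> splitting C X X"
    using splitting_natural[of ?i ?z] X by simp
  also have "copair C ?i ?i \<cdot> ((coprod_map C ?i ?z \<cdot> splitting C X X) \<cdot> PArr C (pair C ?i ?i))
      = (copair C ?i ?i \<cdot> coprod_map C ?i ?z) \<cdot> (splitting C X X \<cdot> PArr C (pair C ?i ?i))"
    using X by (simp del: copair_coprod_map)
  also have "copair C ?i ?i \<cdot> coprod_map C ?i ?z = Pr1 C X X \<cdot> comparison C X X"
    using X by (simp add: comparison_def)
  also have "(Pr1 C X X \<cdot> comparison C X X) \<cdot> (splitting C X X \<cdot> PArr C (pair C ?i ?i))
      = Pr1 C X X \<cdot> ((comparison C X X \<cdot> splitting C X X) \<cdot> PArr C (pair C ?i ?i))"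
    using X by (simp add: comparison_def)
  also have "\<dots> = eps C X"
    unfolding comparison_splitting[OF X X] using X by simp
  finally show ?thesis .
qed

lemma imag_plus_comp_P:
  assumes "a \<in> imag_hom C T X" "b \<in> imag_hom C T X" "u \<in> hom C S T"
  shows "imag_plus C T a b \<cdot> PArr C u = imag_plus C S (a \<cdot> PArr C u) (b \<cdot> PArr C u)"
proof -
  have t: "u \<in> Arr C" "Dom C u = S" "Cod C u = T" "T \<in> Obj C" "S \<in> Obj C" "X \<in> Obj C"
    "a \<in> Arr C" "Dom C a = PObj C T" "Cod C a = X" "b \<in> Arr C" "Dom C b = PObj C T" "Cod C b = X"
    using assms by (auto simp: hom_def imag_hom_def)
  have "PArr C (pair C (a \<cdot> PArr C u) (b \<cdot> PArr C u)) = PArr C (pair C a b) \<cdot> PArr C (PArr C u)"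
    using t by (simp flip: P_comp)
  thus ?thesis using t by (simp add: imag_plus_def imag_comp_def)
qed

lemma comp_imag_plus:
  assumes "a \<in> imag_hom C T X" "b \<in> imag_hom C T X" "T \<in> Obj C" "g \<in> hom C X Y"
  shows "g \<cdot> imag_plus C T a b = imag_plus C T (g \<cdot> a) (g \<cdot> b)"
proof -
  have t: "T \<in> Obj C" "X \<in> Obj C" "Y \<in> Obj C" "g \<in> Arr C" "Dom C g = X" "Cod C g = Y"
    "a \<in> Arr C" "Dom C a = PObj C T" "Cod C a = X" "b \<in> Arr C" "Dom C b = PObj C T" "Cod C b = X"
    using assms by (auto simp: hom_def imag_hom_def)
  have "PArr C (pair C (g \<cdot> a) (g \<cdot> b)) = PArr C (prod_map C g g) \<cdot> PArr C (pair C a b)"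
    using t by (simp flip: P_comp)
  hence "imag_plus C T (g \<cdot> a) (g \<cdot> b)
     = (imag_add C Y \<cdot> PArr C (prod_map C g g)) \<cdot> (PArr C (pair C a b) \<cdot> delta C T)"
    using t by (simp add: imag_plus_def imag_comp_def)
  thus ?thesis unfolding imag_add_natural[OF assms(4)]
    using t by (simp add: imag_plus_def imag_comp_def)
qed

lemma imag_plus_zero:
  assumes "a \<in> imag_hom C T X" "T \<in> Obj C"
  shows "imag_plus C T a (zero_arr C (PObj C T) X) = a"
proof -
  have t: "T \<in> Obj C" "X \<in> Obj C" "a \<in> Arr C" "Dom C a = PObj C T" "Cod C a = X"
    using assms by (auto simp: hom_def imag_hom_def)
  have "zero_arr C X X \<cdot> a = zero_arr C (PObj C T) X"
    using zero_arr_comp[OF pointed] assms t by (auto simp: imag_hom_def)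
  hence "PArr C (pair C a (zero_arr C (PObj C T) X))
      = PArr C (pair C (Ident C X) (zero_arr C X X)) \<cdot> PArr C a"
    using t by (simp flip: P_comp)
  hence "imag_plus C T a (zero_arr C (PObj C T) X)
      = (imag_add C X \<cdot> PArr C (pair C (Ident C X) (zero_arr C X X))) \<cdot> (PArr C a \<cdot> delta C T)"
    using t by (simp add: imag_plus_def imag_comp_def)
  thus ?thesis unfolding imag_add_right_zero[OF t(2)] using t by simp
qed

end

section \<open>Schreier retractions on imaginary elements\<close>

text \<open>The two equations of an intrinsic Schreier split epimorphism in terms of elements:
  \<open>x = k (q x) + s (f x)\<close>, stated for the generic element \<open>\<epsilon>\<close> of \<open>X\<close>, and \<open>q (k a + s y) = a\<close> for
  all imaginary elements \<open>a\<close> and \<open>y\<close> over a common object.\<close>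
definition schreier_retraction ::
  "('o, 'm, 'z) imaginary_cat_scheme \<Rightarrow> 'o \<Rightarrow> 'o \<Rightarrow> 'o \<Rightarrow> 'm \<Rightarrow> 'm \<Rightarrow> 'm \<Rightarrow> 'm \<Rightarrow> bool" where
  "schreier_retraction C K X Y k f s q \<longleftrightarrow>
     k \<in> hom C K X \<and> f \<in> hom C X Y \<and> s \<in> hom C Y X \<and> q \<in> imag_hom C X K \<and>
     imag_plus C X (k \<cdot>\<^bsub>C\<^esub> q) (s \<cdot>\<^bsub>C\<^esub> f \<cdot>\<^bsub>C\<^esub> eps C X) = eps C X \<and>
     (\<forall>T\<in>Obj C. \<forall>a\<in>imag_hom C T K. \<forall>y\<in>imag_hom C T Y.
        imag_comp C T q (imag_plus C T (k \<cdot>\<^bsub>C\<^esub> a) (s \<cdot>\<^bsub>C\<^esub> y)) = a)"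

context imaginary_splitting
begin

text \<open>The second equation is given for the generic pair in \<open>K \<times> Y\<close> only; composing it in the
  Kleisli category with \<open>\<langle>a, y\<rangle>\<close> yields it for all imaginary elements.\<close>
lemma intrinsic_schreier_retraction:
  assumes "intrinsic_schreier C K X Y k f s"
  obtains q where "schreier_retraction C K X Y k f s q"
proof -
  obtain q where q: "q \<in> imag_hom C X K"
    and q1: "imag_comp C X (imag_add C X) (pair C (k \<cdot> q) (real_arr C (s \<cdot> f)))
          = real_arr C (Ident C X)"
    and q2: "imag_comp C (Prod C X X) q (imag_add C X) \<cdot> PArr C (prod_map C k s)
          = real_arr C (Pr1 C K Y)"
    using assms unfolding intrinsic_schreier_def by blast
  have h: "k \<in> hom C K X" "f \<in> hom C X Y" "s \<in> hom C Y X"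
    using assms by (auto simp: intrinsic_schreier_def)
  have t: "k \<in> Arr C" "Dom C k = K" "Cod C k = X" "f \<in> Arr C" "Dom C f = X" "Cod C f = Y"
    "s \<in> Arr C" "Dom C s = Y" "Cod C s = X" "q \<in> Arr C" "Dom C q = PObj C X" "Cod C q = K"
    "K \<in> Obj C" "X \<in> Obj C" "Y \<in> Obj C"
    using h q by (auto simp: hom_def imag_hom_def)
  have "imag_plus C X (k \<cdot> q) (s \<cdot> f \<cdot> eps C X) = eps C X"
    using q1 t by (simp add: imag_plus_def real_arr_def)
  moreover have "imag_comp C T q (imag_plus C T (k \<cdot> a) (s \<cdot> y)) = a"
    if T: "T \<in> Obj C" and a: "a \<in> imag_hom C T K" and y: "y \<in> imag_hom C T Y" for T a y
  proof -
    have t': "a \<in> Arr C" "Dom C a = PObj C T" "Cod C a = K"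
      "y \<in> Arr C" "Dom C y = PObj C T" "Cod C y = Y"
      using a y by (auto simp: hom_def imag_hom_def)
    have "PArr C (pair C (k \<cdot> a) (s \<cdot> y)) = PArr C (prod_map C k s) \<cdot> PArr C (pair C a y)"
      using t t' T by (simp flip: P_comp)
    hence "imag_comp C T q (imag_plus C T (k \<cdot> a) (s \<cdot> y))
      = (imag_comp C (Prod C X X) q (imag_add C X) \<cdot> PArr C (prod_map C k s))
          \<cdot> (PArr C (pair C a y) \<cdot> delta C T)"
      using t t' T by (simp add: imag_plus_def imag_comp_def)
    also have "\<dots> = a"
      unfolding q2 using t t' T by (simp add: real_arr_def)
    finally show ?thesis .
  qed
  ultimately have "schreier_retraction C K X Y k f s q"
    using h q by (auto simp: schreier_retraction_def)
  thus thesis by (rule that)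
qed

text \<open>This is \<open>q (k a + s 0) = a\<close>, with \<open>k a + s 0 = k a\<close>, at the generic element \<open>a\<close> of \<open>K\<close>.\<close>
lemma schreier_retraction_kernel:
  assumes r: "schreier_retraction C K X Y k f s q"
  shows "q \<cdot> PArr C k = eps C K"
proof -
  have h: "k \<in> hom C K X" "f \<in> hom C X Y" "s \<in> hom C Y X" "q \<in> imag_hom C X K"
    using r by (auto simp: schreier_retraction_def)
  hence t: "k \<in> Arr C" "Dom C k = K" "Cod C k = X" "s \<in> Arr C" "Dom C s = Y" "Cod C s = X"
    "q \<in> Arr C" "Dom C q = PObj C X" "Cod C q = K" "K \<in> Obj C" "X \<in> Obj C" "Y \<in> Obj C"
    by (auto simp: hom_def imag_hom_def)
  let ?z = "zero_arr C (PObj C K) Y"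
  have "s \<cdot> ?z = zero_arr C (PObj C K) X"
    using comp_zero_arr[OF pointed] h(3) t by simp
  hence "imag_plus C K (k \<cdot> eps C K) (s \<cdot> ?z) = k \<cdot> eps C K"
    using t by (simp add: imag_plus_zero imag_hom_def hom_def)
  moreover have "imag_comp C K q (imag_plus C K (k \<cdot> eps C K) (s \<cdot> ?z)) = eps C K"
    using r t by (auto simp: schreier_retraction_def imag_hom_def hom_def)
  ultimately show ?thesis using t by (simp add: imag_comp_def)
qed

text \<open>Apply \<open>q\<close> to \<open>g x' = g (k' (q' x') + s' (f' x')) = k (\<gamma> (q' x')) + s (h (f' x'))\<close>.\<close>
lemma schreier_retraction_natural:
  assumes r': "schreier_retraction C K' X' Y' k' f' s' q'"
    and r: "schreier_retraction C K X Y k f s q"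
    and h: "\<gamma> \<in> hom C K' K" "g \<in> hom C X' X" "h \<in> hom C Y' Y"
    and eqs: "g \<cdot> k' = k \<cdot> \<gamma>" "g \<cdot> s' = s \<cdot> h"
  shows "\<gamma> \<cdot> q' = q \<cdot> PArr C g"
proof -
  have t: "k \<in> Arr C" "Dom C k = K" "Cod C k = X" "s \<in> Arr C" "Dom C s = Y" "Cod C s = X"
    "q \<in> Arr C" "Dom C q = PObj C X" "Cod C q = K" "K \<in> Obj C" "X \<in> Obj C" "Y \<in> Obj C"
    "k' \<in> Arr C" "Dom C k' = K'" "Cod C k' = X'" "s' \<in> Arr C" "Dom C s' = Y'" "Cod C s' = X'"
    "f' \<in> Arr C" "Dom C f' = X'" "Cod C f' = Y'"
    "q' \<in> Arr C" "Dom C q' = PObj C X'" "Cod C q' = K'" "K' \<in> Obj C" "X' \<in> Obj C" "Y' \<in> Obj C"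
    "\<gamma> \<in> Arr C" "Dom C \<gamma> = K'" "Cod C \<gamma> = K" "g \<in> Arr C" "Dom C g = X'" "Cod C g = X"
    "h \<in> Arr C" "Dom C h = Y'" "Cod C h = Y"
    using r r' h unfolding schreier_retraction_def by (auto simp: hom_def imag_hom_def)
  let ?y = "f' \<cdot> eps C X'"
  have "g \<cdot> eps C X' = g \<cdot> imag_plus C X' (k' \<cdot> q') (s' \<cdot> ?y)"
    using r' t by (simp add: schreier_retraction_def)
  also have "\<dots> = imag_plus C X' (g \<cdot> (k' \<cdot> q')) (g \<cdot> (s' \<cdot> ?y))"
    using t by (intro comp_imag_plus) (auto simp: imag_hom_def hom_def)
  also have "g \<cdot> (k' \<cdot> q') = (g \<cdot> k') \<cdot> q'" using t by simp
  also have "g \<cdot> (s' \<cdot> ?y) = (g \<cdot> s') \<cdot> ?y" using t by simp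
  also have "(g \<cdot> k') \<cdot> q' = k \<cdot> (\<gamma> \<cdot> q')" unfolding eqs(1) using t by simp
  also have "(g \<cdot> s') \<cdot> ?y = s \<cdot> (h \<cdot> ?y)" unfolding eqs(2) using t by simp
  finally have "imag_comp C X' q (g \<cdot> eps C X')
      = imag_comp C X' q (imag_plus C X' (k \<cdot> (\<gamma> \<cdot> q')) (s \<cdot> (h \<cdot> ?y)))" by simp
  also have "\<dots> = \<gamma> \<cdot> q'"
    using r t by (auto simp: schreier_retraction_def imag_hom_def hom_def)
  finally show ?thesis using t by (simp add: imag_comp_def)
qed


section \<open>Morphisms of Schreier split extensions\<close>

text \<open>An element of \<open>X'\<close> is determined by its images under \<open>q'\<close> and \<open>f'\<close>, and these are
  determined by its image under \<open>g\<close> because \<open>\<gamma> q' = q g\<close> and \<open>h f' = f g\<close>.\<close>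
lemma schreier_morphism_monic:
  assumes r': "schreier_retraction C K' X' Y' k' f' s' q'"
    and r: "schreier_retraction C K X Y k f s q"
    and h: "\<gamma> \<in> hom C K' K" "g \<in> hom C X' X" "h \<in> hom C Y' Y"
    and eqs: "g \<cdot> k' = k \<cdot> \<gamma>" "f \<cdot> g = h \<cdot> f'" "g \<cdot> s' = s \<cdot> h"
    and monic: "monic C \<gamma>" "monic C h"
  shows "monic C g"
proof -
  have t: "f \<in> Arr C" "Dom C f = X" "Cod C f = Y"
    "q \<in> Arr C" "Dom C q = PObj C X" "Cod C q = K" "K \<in> Obj C" "X \<in> Obj C" "Y \<in> Obj C"
    "k' \<in> Arr C" "Dom C k' = K'" "Cod C k' = X'" "s' \<in> Arr C" "Dom C s' = Y'" "Cod C s' = X'"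
    "f' \<in> Arr C" "Dom C f' = X'" "Cod C f' = Y'"
    "q' \<in> Arr C" "Dom C q' = PObj C X'" "Cod C q' = K'" "K' \<in> Obj C" "X' \<in> Obj C" "Y' \<in> Obj C"
    "\<gamma> \<in> Arr C" "Dom C \<gamma> = K'" "Cod C \<gamma> = K" "g \<in> Arr C" "Dom C g = X'" "Cod C g = X"
    "h \<in> Arr C" "Dom C h = Y'" "Cod C h = Y"
    using r r' h unfolding schreier_retraction_def by (auto simp: hom_def imag_hom_def)
  have nat: "\<gamma> \<cdot> q' = q \<cdot> PArr C g"
    by (rule schreier_retraction_natural[OF r' r h eqs(1,3)])
  have "u = v" if uv: "u \<in> hom C T X'" "v \<in> hom C T X'" "g \<cdot> u = g \<cdot> v" for T u v
  proof -
    have uvt: "u \<in> Arr C" "Dom C u = T" "Cod C u = X'" "v \<in> Arr C" "Dom C v = T" "Cod C v = X'"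
      "T \<in> Obj C"
      using uv by (auto simp: hom_def)
    have "\<gamma> \<cdot> (q' \<cdot> PArr C w) = q \<cdot> PArr C (g \<cdot> w)" if "w \<in> hom C T X'" for w
    proof -
      have "\<gamma> \<cdot> (q' \<cdot> PArr C w) = (\<gamma> \<cdot> q') \<cdot> PArr C w" using that t by (simp add: hom_def)
      thus ?thesis unfolding nat using that t by (simp add: hom_def)
    qed
    hence qeq: "\<gamma> \<cdot> (q' \<cdot> PArr C u) = \<gamma> \<cdot> (q' \<cdot> PArr C v)" using uv by metis
    have q'uv: "q' \<cdot> PArr C u = q' \<cdot> PArr C v"
      by (rule monic_cancel[OF monic(1) _ _ qeq, of "PObj C T"])
        (use t uvt in \<open>auto simp: hom_def\<close>)
    have "h \<cdot> (f' \<cdot> w) = f \<cdot> (g \<cdot> w)" if "w \<in> hom C T X'" for w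
    proof -
      have "h \<cdot> (f' \<cdot> w) = (h \<cdot> f') \<cdot> w" using that t by (simp add: hom_def)
      thus ?thesis unfolding eqs(2)[symmetric] using that t by (simp add: hom_def)
    qed
    hence feq: "h \<cdot> (f' \<cdot> u) = h \<cdot> (f' \<cdot> v)" using uv by metis
    have f'uv: "f' \<cdot> u = f' \<cdot> v"
      by (rule monic_cancel[OF monic(2) _ _ feq, of T]) (use t uvt in \<open>auto simp: hom_def\<close>)
    have decompose: "w \<cdot> eps C T
        = imag_plus C T (k' \<cdot> (q' \<cdot> PArr C w)) (s' \<cdot> (f' \<cdot> w) \<cdot> eps C T)"
      if w: "w \<in> hom C T X'" for w
    proof -
      have "w \<cdot> eps C T = eps C X' \<cdot> PArr C w" using w by (simp add: hom_def)
      also have "\<dots> = imag_plus C X' (k' \<cdot> q') (s' \<cdot> f' \<cdot> eps C X') \<cdot> PArr C w"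
        using r' by (simp add: schreier_retraction_def)
      also have "\<dots> = imag_plus C T (k' \<cdot> q' \<cdot> PArr C w) (s' \<cdot> f' \<cdot> eps C X' \<cdot> PArr C w)"
        by (rule imag_plus_comp_P[OF _ _ w]) (use t in \<open>auto simp: imag_hom_def hom_def\<close>)
      finally show ?thesis using w t uvt by (simp add: hom_def)
    qed
    \<comment> \<open>The real elements are compared only after precomposition with the epimorphism \<open>\<epsilon>\<close>.\<close>
    have "u \<cdot> eps C T = v \<cdot> eps C T"
      using decompose[OF uv(1)] decompose[OF uv(2)] q'uv f'uv by simp
    thus "u = v"
      using regular_epi_cancel[OF regular_epi_eps[OF uvt(7)]] uv uvt by simp
  qed
  thus ?thesis using t by (auto simp: monic_def)
qed

text \<open>Both imaginary sections come from one of \<open>g\<close>: a preimage of \<open>y\<close> under \<open>h\<close> is \<open>f' (\<sigma> (s y))\<close>,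
  and a preimage of \<open>a\<close> under \<open>\<gamma>\<close> is \<open>q' (\<sigma> (k a))\<close>.\<close>
lemma schreier_morphism_regular_epi_parts:
  assumes r': "schreier_retraction C K' X' Y' k' f' s' q'"
    and r: "schreier_retraction C K X Y k f s q" and fs: "f \<cdot> s = Ident C Y"
    and h: "\<gamma> \<in> hom C K' K" "g \<in> hom C X' X" "h \<in> hom C Y' Y"
    and eqs: "g \<cdot> k' = k \<cdot> \<gamma>" "f \<cdot> g = h \<cdot> f'" "g \<cdot> s' = s \<cdot> h"
    and proj: "projective C (PObj C X)" and g: "regular_epi C g"
  shows "regular_epi C \<gamma>" "regular_epi C h"
proof -
  have t: "f \<in> Arr C" "Dom C f = X" "Cod C f = Y" "s \<in> Arr C" "Dom C s = Y" "Cod C s = X"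
    "k \<in> Arr C" "Dom C k = K" "Cod C k = X"
    "q \<in> Arr C" "Dom C q = PObj C X" "Cod C q = K" "K \<in> Obj C" "X \<in> Obj C" "Y \<in> Obj C"
    "f' \<in> Arr C" "Dom C f' = X'" "Cod C f' = Y'"
    "q' \<in> Arr C" "Dom C q' = PObj C X'" "Cod C q' = K'" "K' \<in> Obj C" "X' \<in> Obj C" "Y' \<in> Obj C"
    "\<gamma> \<in> Arr C" "Dom C \<gamma> = K'" "Cod C \<gamma> = K" "g \<in> Arr C" "Dom C g = X'" "Cod C g = X"
    "h \<in> Arr C" "Dom C h = Y'" "Cod C h = Y"
    using r r' h unfolding schreier_retraction_def by (auto simp: hom_def imag_hom_def)
  obtain \<sigma> where \<sigma>: "\<sigma> \<in> imag_hom C X X'" and sec: "g \<cdot> \<sigma> = eps C X"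
    by (rule imaginary_section_of_regular_epi[OF g h(2) proj])
  have \<sigma>t: "\<sigma> \<in> Arr C" "Dom C \<sigma> = PObj C X" "Cod C \<sigma> = X'"
    using \<sigma> by (auto simp: imag_hom_def hom_def)
  have "h \<cdot> (f' \<cdot> (\<sigma> \<cdot> PArr C s)) = (h \<cdot> f') \<cdot> (\<sigma> \<cdot> PArr C s)" using t \<sigma>t by simp
  also have "\<dots> = f \<cdot> ((g \<cdot> \<sigma>) \<cdot> PArr C s)" unfolding eqs(2)[symmetric] using t \<sigma>t by simp
  also have "\<dots> = (f \<cdot> s) \<cdot> eps C Y" unfolding sec using t by simp
  finally have "h \<cdot> (f' \<cdot> (\<sigma> \<cdot> PArr C s)) = eps C Y" using t by (simp add: fs)
  thus "regular_epi C h"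
    using t \<sigma>t by (intro regular_epi_of_imaginary_section[OF h(3)]) (auto simp: imag_hom_def hom_def)
  \<comment> \<open>The Kleisli composite \<open>q' \<sigma> k\<close>; \<open>q'\<close> is only imaginary, so a plain composite is not possible.\<close>
  let ?\<tau> = "imag_comp C K q' (\<sigma> \<cdot> PArr C k)"
  have "\<gamma> \<cdot> ?\<tau> = (\<gamma> \<cdot> q') \<cdot> (PArr C (\<sigma> \<cdot> PArr C k) \<cdot> delta C K)"
    using t \<sigma>t by (simp add: imag_comp_def)
  also have "\<gamma> \<cdot> q' = q \<cdot> PArr C g"
    by (rule schreier_retraction_natural[OF r' r h eqs(1,3)])
  also have "(q \<cdot> PArr C g) \<cdot> (PArr C (\<sigma> \<cdot> PArr C k) \<cdot> delta C K)
      = q \<cdot> (PArr C ((g \<cdot> \<sigma>) \<cdot> PArr C k) \<cdot> delta C K)"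
    using t \<sigma>t by simp
  also have "(g \<cdot> \<sigma>) \<cdot> PArr C k = k \<cdot> eps C K" unfolding sec using t by simp
  also have "q \<cdot> (PArr C (k \<cdot> eps C K) \<cdot> delta C K) = eps C K"
    using t by (simp add: schreier_retraction_kernel[OF r])
  finally show "regular_epi C \<gamma>"
    using t \<sigma>t
    by (intro regular_epi_of_imaginary_section[OF h(1)]) (auto simp: imag_hom_def hom_def imag_comp_def)
qed

text \<open>With imaginary sections \<open>\<tau>\<close> of \<open>\<gamma>\<close> and \<open>\<rho>\<close> of \<open>h\<close>, the element
  \<open>k' (\<tau> (q x)) + s' (\<rho> (f x))\<close> is mapped by \<open>g\<close> to \<open>k (q x) + s (f x) = x\<close>.\<close>
lemma schreier_morphism_regular_epi:
  assumes r': "schreier_retraction C K' X' Y' k' f' s' q'"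
    and r: "schreier_retraction C K X Y k f s q"
    and h: "\<gamma> \<in> hom C K' K" "g \<in> hom C X' X" "h \<in> hom C Y' Y"
    and eqs: "g \<cdot> k' = k \<cdot> \<gamma>" "g \<cdot> s' = s \<cdot> h"
    and proj: "projective C (PObj C K)" "projective C (PObj C Y)"
    and epi: "regular_epi C \<gamma>" "regular_epi C h"
  shows "regular_epi C g"
proof -
  have t: "f \<in> Arr C" "Dom C f = X" "Cod C f = Y" "s \<in> Arr C" "Dom C s = Y" "Cod C s = X"
    "k \<in> Arr C" "Dom C k = K" "Cod C k = X"
    "q \<in> Arr C" "Dom C q = PObj C X" "Cod C q = K" "K \<in> Obj C" "X \<in> Obj C" "Y \<in> Obj C"
    "k' \<in> Arr C" "Dom C k' = K'" "Cod C k' = X'" "s' \<in> Arr C" "Dom C s' = Y'" "Cod C s' = X'"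
    "K' \<in> Obj C" "X' \<in> Obj C" "Y' \<in> Obj C"
    "\<gamma> \<in> Arr C" "Dom C \<gamma> = K'" "Cod C \<gamma> = K" "g \<in> Arr C" "Dom C g = X'" "Cod C g = X"
    "h \<in> Arr C" "Dom C h = Y'" "Cod C h = Y"
    using r r' h unfolding schreier_retraction_def by (auto simp: hom_def imag_hom_def)
  obtain \<tau> where \<tau>: "\<tau> \<in> imag_hom C K K'" and sec_\<gamma>: "\<gamma> \<cdot> \<tau> = eps C K"
    by (rule imaginary_section_of_regular_epi[OF epi(1) h(1) proj(1)])
  obtain \<rho> where \<rho>: "\<rho> \<in> imag_hom C Y Y'" and sec_h: "h \<cdot> \<rho> = eps C Y"
    by (rule imaginary_section_of_regular_epi[OF epi(2) h(3) proj(2)])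
  have \<tau>t: "\<tau> \<in> Arr C" "Dom C \<tau> = PObj C K" "Cod C \<tau> = K'"
    "\<rho> \<in> Arr C" "Dom C \<rho> = PObj C Y" "Cod C \<rho> = Y'"
    using \<tau> \<rho> by (auto simp: imag_hom_def hom_def)
  let ?a = "k' \<cdot> (\<tau> \<cdot> (PArr C q \<cdot> delta C X))" and ?b = "s' \<cdot> (\<rho> \<cdot> PArr C f)"
  have "g \<cdot> ?a = (g \<cdot> k') \<cdot> (\<tau> \<cdot> (PArr C q \<cdot> delta C X))" using t \<tau>t by simp
  also have "\<dots> = k \<cdot> ((\<gamma> \<cdot> \<tau>) \<cdot> (PArr C q \<cdot> delta C X))" unfolding eqs(1) using t \<tau>t by simp
  also have "\<dots> = k \<cdot> q" unfolding sec_\<gamma> using t by simp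
  finally have a: "g \<cdot> ?a = k \<cdot> q" .
  have "g \<cdot> ?b = (g \<cdot> s') \<cdot> (\<rho> \<cdot> PArr C f)" using t \<tau>t by simp
  also have "\<dots> = s \<cdot> ((h \<cdot> \<rho>) \<cdot> PArr C f)" unfolding eqs(2) using t \<tau>t by simp
  also have "\<dots> = s \<cdot> f \<cdot> eps C X" unfolding sec_h using t by simp
  finally have b: "g \<cdot> ?b = s \<cdot> f \<cdot> eps C X" .
  have ab: "?a \<in> imag_hom C X X'" "?b \<in> imag_hom C X X'"
    using t \<tau>t by (auto simp: imag_hom_def hom_def)
  have "g \<cdot> imag_plus C X ?a ?b = eps C X"
    unfolding comp_imag_plus[OF ab t(14) h(2)] a b using r by (simp add: schreier_retraction_def)
  moreover have "imag_plus C X ?a ?b \<in> imag_hom C X X'"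
    using t \<tau>t by (simp add: imag_hom_def hom_def imag_plus_def imag_comp_def)
  ultimately show ?thesis by (intro regular_epi_of_imaginary_section[OF h(2)])
qed

end

theorem proposition7p9:
  fixes C :: "('o, 'm, 'z) imaginary_cat_scheme"
  assumes "regular_category C"
    and "unital_category C"
    and "binary_coproducts C"
    and "comonadic_covers C"
    and "natural_imaginary_splitting C"
    and "\<forall>X\<in>Obj C. projective C (PObj C X)"
    and "intrinsic_schreier C K' X' Y' k' f' s'"
    and "intrinsic_schreier C K X Y k f s"
    and "\<gamma> \<in> hom C K' K"
    and "g \<in> hom C X' X"
    and "h \<in> hom C Y' Y"
    and "g \<cdot>\<^bsub>C\<^esub> k' = k \<cdot>\<^bsub>C\<^esub> \<gamma>"
    and "f \<cdot>\<^bsub>C\<^esub> g = h \<cdot>\<^bsub>C\<^esub> f'"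
    and "g \<cdot>\<^bsub>C\<^esub> s' = s \<cdot>\<^bsub>C\<^esub> h"
  shows "(regular_epi C g \<longleftrightarrow> regular_epi C \<gamma> \<and> regular_epi C h) \<and>
         (monic C g \<longleftrightarrow> monic C \<gamma> \<and> monic C h)"
proof -
  note h = assms(9-11) and eqs = assms(12-14)
  interpret category C using assms(1) by (simp add: regular_category_def)
  interpret imaginary_splitting C
    by unfold_locales (use assms(2-5) in \<open>auto simp: unital_category_def\<close>)
  obtain q' where r': "schreier_retraction C K' X' Y' k' f' s' q'"
    by (rule intrinsic_schreier_retraction[OF assms(7)])
  obtain q where r: "schreier_retraction C K X Y k f s q"
    by (rule intrinsic_schreier_retraction[OF assms(8)])
  have split': "k' \<in> hom C K' X'" "f' \<in> hom C X' Y'" "s' \<in> hom C Y' X'" "f' \<cdot>\<^bsub>C\<^esub> s' = Ident C Y'"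
      "is_kernel C k' f'"
    and split: "k \<in> hom C K X" "f \<in> hom C X Y" "s \<in> hom C Y X" "f \<cdot>\<^bsub>C\<^esub> s = Ident C Y"
    using assms(7,8) by (auto simp: intrinsic_schreier_def)
  have proj: "projective C (PObj C K)" "projective C (PObj C X)" "projective C (PObj C Y)"
    using assms(6) split dom_obj cod_obj by (auto simp: hom_def)
  have "regular_epi C g \<longleftrightarrow> regular_epi C \<gamma> \<and> regular_epi C h"
    using schreier_morphism_regular_epi_parts[OF r' r split(4) h eqs proj(2)]
      schreier_morphism_regular_epi[OF r' r h eqs(1,3) proj(1,3)] by blast
  moreover have "monic C \<gamma>" if "monic C g"
  proof (rule monic_cancel_left[OF h(1) split(1)])
    show "monic C (k \<cdot>\<^bsub>C\<^esub> \<gamma>)"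
      using monic_comp[OF split'(1) h(2) kernel_monic[OF pointed split'(5)] that] by (simp add: eqs)
  qed
  moreover have "monic C h" if "monic C g"
  proof (rule monic_cancel_left[OF h(3) split(3)])
    show "monic C (s \<cdot>\<^bsub>C\<^esub> h)"
      using monic_comp[OF split'(3) h(2) split_monic[OF split'(3,2,4)] that] by (simp add: eqs)
  qed
  ultimately show ?thesis
    using schreier_morphism_monic[OF r' r h eqs] by blast
qed

end
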